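(* Let $\alpha\in\mathbb{N}$, and let $\Xi\subset\mathbb{R}$ be finite, non-empty and symmetric. Then the function $$f^\star\colon\mathbb{R}\to\mathbb{R},\qquad a\mapsto(\partial^\alpha\cos)(2\pi\cdot\max\Xi\cdot a)$$ is an optimal solution to the dual optimization problem $$\sup\{(-\partial)^\alpha f(0)\mid f\in\mathscr{K}_\Xi,\ \|f\|_\infty\le1\}.$$ In particular, the cost of an optimal shift rule for $\Xi,\alpha$ is $(2\pi\max\Xi)^\alpha$.
   Context: $\mathbb{N}=\{1,2,3,\dots\}$. A set $\Xi\subset\mathbb{R}$ is symmetric if $\Xi=-\Xi$. $\mathscr{K}_\Xi$ denotes the real vector space of functions $f\colon\mathbb{R}\to\mathbb{R}$ of the form $f(x)=\sum_{\xi\in\Xi}b_\xi e^{2\pi i\,\xi x}$ with $b\in\mathbb{C}^\Xi$, $b_{-\xi}=\overline{b_\xi}$. $\|f\|_\infty=\sup_x|f(x)|$. $\partial^\alpha$ is the $\alpha$-th derivative, $(-\partial)^\alpha=(-1)^\alpha\partial^\alpha$, and $\partial^\alpha\cos$ is the $\alpha$-th derivative of the cosine function. A (finite) shift rule is a real signed measure of finite support $\phi=\sum_{a\in A}u_a\delta_a$, with $A\subset\mathbb{R}$ finite and $u\in\mathbb{R}^A$; it acts by $(\phi*f)(x)=\sum_{a\in A}u_af(x-a)$. Its cost is $\|\phi\|_1=\sum_{a\in A}|u_a|$. It is feasible for $\Xi,\alpha$ if $\phi*g=\partial^\alpha g$ for all $g\in\mathscr{K}_\Xi$. It is optimal if it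 is feasible and its cost equals the infimum of the costs of all finite feasible shift rules. *)

theory Defs
  imports "HOL-Analysis.Analysis" "HOL-Library.Poly_Mapping"
begin

definition symmetric_set :: "real set \<Rightarrow> bool" where
  "symmetric_set \<Xi> \<longleftrightarrow> \<Xi> = uminus ` \<Xi>"

text \<open>The function space is only meaningful for finite \<open>\<Xi>\<close>, since \<open>sum\<close> is \<open>0\<close> over
  infinite sets. Values of \<open>b\<close> outside \<open>\<Xi>\<close> play no role when \<open>\<Xi>\<close> is symmetric.\<close>

definition fun_space :: "real set \<Rightarrow> (real \<Rightarrow> real) set" where
  "fun_space \<Xi> = {f. \<exists>b :: real \<Rightarrow> complex. (\<forall>\<xi>\<in>\<Xi>. b (- \<xi>) = cnj (b \<xi>)) \<and>
     (\<forall>x. complex_of_real (f x) =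
        (\<Sum>\<xi>\<in>\<Xi>. b \<xi> * exp (2 * complex_of_real pi * \<i> * complex_of_real \<xi> * complex_of_real x)))}"

text \<open>A real-valued supremum: intended for bounded functions, in particular for the elements of
  \<open>fun_space \<Xi>\<close> with \<open>\<Xi>\<close> finite.\<close>

definition sup_norm :: "(real \<Rightarrow> real) \<Rightarrow> real" where
  "sup_norm f = (SUP x. \<bar>f x\<bar>)"

text \<open>The finitely supported signed measure \<open>\<Sum>a\<in>A. u a \<cdot> \<delta> a\<close> is encoded by the finitely
  supported function giving the mass of each point.\<close>

type_synonym shift_rule = "real \<Rightarrow>\<^sub>0 real"

definition apply_rule :: "shift_rule \<Rightarrow> (real \<Rightarrow> real) \<Rightarrow> real \<Rightarrow> real" where
  "apply_rule \<phi> f x = (\<Sum>a\<in>Poly_Mapping.keys \<phi>. Poly_Mapping.lookup \<phi> a * f (x - a))"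

definition rule_cost :: "shift_rule \<Rightarrow> real" where
  "rule_cost \<phi> = (\<Sum>a\<in>Poly_Mapping.keys \<phi>. \<bar>Poly_Mapping.lookup \<phi> a\<bar>)"

definition feasible_rule :: "real set \<Rightarrow> nat \<Rightarrow> shift_rule \<Rightarrow> bool" where
  "feasible_rule \<Xi> \<alpha> \<phi> \<longleftrightarrow> (\<forall>g\<in>fun_space \<Xi>. apply_rule \<phi> g = (deriv ^^ \<alpha>) g)"

definition optimal_rule :: "real set \<Rightarrow> nat \<Rightarrow> shift_rule \<Rightarrow> bool" where
  "optimal_rule \<Xi> \<alpha> \<phi> \<longleftrightarrow> feasible_rule \<Xi> \<alpha> \<phi> \<and>
     rule_cost \<phi> = (INF \<psi>\<in>{\<psi>. feasible_rule \<Xi> \<alpha> \<psi>}. rule_cost \<psi>)"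

definition dual_feasible :: "real set \<Rightarrow> (real \<Rightarrow> real) set" where
  "dual_feasible \<Xi> = {f \<in> fun_space \<Xi>. sup_norm f \<le> 1}"

definition dual_objective :: "nat \<Rightarrow> (real \<Rightarrow> real) \<Rightarrow> real" where
  "dual_objective \<alpha> f = (- 1) ^ \<alpha> * (deriv ^^ \<alpha>) f 0"

definition dual_optimal :: "real set \<Rightarrow> nat \<Rightarrow> (real \<Rightarrow> real) \<Rightarrow> bool" where
  "dual_optimal \<Xi> \<alpha> f \<longleftrightarrow> f \<in> dual_feasible \<Xi> \<and>
     (\<forall>g\<in>dual_feasible \<Xi>. dual_objective \<alpha> g \<le> dual_objective \<alpha> f)"

end

theory Submission imports Defs begin

text \<open>
  Every feasible rule bounds the dual objective by its cost, so it suffices to exhibit a rule of cost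
  at most \<open>(2 pi M) ^ \<alpha>\<close>, where \<open>M = Max \<Xi>\<close>. Rules multiply by convolution, which multiplies symbols
  and is submultiplicative for the cost, so the \<open>\<alpha>\<close>-th power of an optimal rule for \<open>\<alpha> = 1\<close> will do.
  For \<open>\<alpha> = 1\<close>, M. Riesz's interpolation formula (the Fourier series of the triangular wave) is an optimal
  rule with infinite support. Since \<open>\<Xi>\<close> is finite, all points of the support contribute only linear
  combinations of the first few, with bounded coefficients; hence a sufficiently small tail of the series
  can be moved onto the first few points without changing the sign of any weight. The cost of a rule with
  this sign pattern is read off its symbol at \<open>M\<close>.
\<close>

section \<open>The Fourier series of the triangular wave\<close>

text \<open>The factor \<open>2 * cos x\<close> turns the \<open>k\<close>-th sine into
  \<open>sin ((2k+2)x) + sin (2kx)\<close>, so the alternating sum telescopes.\<close>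

lemma sum_alternating_sin:
  fixes x :: real
  shows "2 * cos x * (\<Sum>k<n. (-1) ^ k * sin (real (2 * k + 1) * x)) = - ((-1) ^ n * sin (2 * real n * x))"
proof (induction n)
  case (Suc n)
  have "sin (2 * real (Suc n) * x) = sin (real (2 * n + 1) * x + x)"
    and "sin (2 * real n * x) = sin (real (2 * n + 1) * x - x)"
    by (simp_all add: algebra_simps)
  then have eq: "sin (2 * real (Suc n) * x) + sin (2 * real n * x) = 2 * cos x * sin (real (2 * n + 1) * x)"
    by (simp only: sin_add sin_diff) simp
  have "2 * cos x * (\<Sum>k<Suc n. (-1) ^ k * sin (real (2 * k + 1) * x))
      = - ((-1) ^ n * sin (2 * real n * x)) + (-1) ^ n * (2 * cos x * sin (real (2 * n + 1) * x))"
    unfolding Suc[symmetric] by (simp add: distrib_left mult_ac)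
  also have "\<dots> = - ((-1) ^ Suc n * sin (2 * real (Suc n) * x))"
    unfolding eq[symmetric] distrib_left by simp
  finally show ?case .
qed auto

lemma summable_inverse_odd_squares: "summable (\<lambda>k. 1 / (real (2 * k + 1))\<^sup>2)"
proof (rule summable_comparison_test')
  show "summable (\<lambda>n. 1 / (real n + 1)\<^sup>2)"
    using inverse_squares_sums by (simp add: sums_iff add.commute)
  show "norm (1 / (real (2 * k + 1))\<^sup>2) \<le> 1 / (real k + 1)\<^sup>2" if "k \<ge> 0" for k :: nat
    by (simp add: frac_le power_mono)
qed

text \<open>The derivative \<open>D n\<close> of the partial sum \<open>S n\<close> is constant up
  to O(1/n) on a compact interval where the cosine is positive, and its value at 0 is a partial sum
  of the Leibniz series for pi/4. Integrating from 0 to \<open>x\<close> gives the limit.\<close>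

lemma alternating_sin_series_interior:
  fixes x :: real
  assumes x: "\<bar>x\<bar> < pi / 2"
  shows "(\<lambda>n. \<Sum>k<n. (-1) ^ k * sin (real (2 * k + 1) * x) / (real (2 * k + 1))\<^sup>2)
           \<longlonglongrightarrow> pi / 4 * x"
proof -
  define S where "S n y = (\<Sum>k<n. (-1) ^ k * sin (real (2 * k + 1) * y) / (real (2 * k + 1))\<^sup>2)"
    for n and y :: real
  define D where "D n y = (\<Sum>k<n. (-1) ^ k * cos (real (2 * k + 1) * y) / real (2 * k + 1))"
    for n and y :: real
  define I where "I = {- \<bar>x\<bar>..\<bar>x\<bar>}"
  \<comment> \<open>The minimum of the cosine on \<open>I\<close>. The error bounds blow up as
    \<open>c\<close> tends to 0, so the endpoints are reached separately, by continuity.\<close>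
  define c where "c = cos x"
  have c0: "0 < c"
    unfolding c_def using x by (intro cos_gt_zero_pi) auto
  have c1: "c \<le> 1"
    by (simp add: c_def)
  \<comment> \<open>This lets the bound on \<open>R\<close>, which has \<open>cos z\<close> in the
    denominator, be stated with the denominator \<open>c\<^sup>2\<close> of the mean value
    estimate.\<close>
  have cc: "c * c \<le> c" using c0 c1 by (simp add: mult_left_le)
  have cos_ge: "c \<le> cos y" if "y \<in> I" for y
  proof -
    have "cos \<bar>x\<bar> \<le> cos \<bar>y\<bar>"
      using that x by (intro cos_monotone_0_pi_le) (auto simp: I_def)
    then show ?thesis by (simp add: c_def)
  qed
  have dS: "(S n has_field_derivative D n y) (at y within I)" for n y
  proof -
    have "((\<lambda>y. s * sin (m * y) / m\<^sup>2) has_field_derivative s * cos (m * y) / m) (at y within I)"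
      if "m \<noteq> 0" for s m :: real
      using that by (auto intro!: derivative_eq_intros simp: power2_eq_square)
    then show ?thesis
      unfolding S_def[abs_def] D_def by (intro DERIV_sum) simp
  qed
  have D_bound: "\<bar>D n y - D n 0\<bar> \<le> 1 / (real n * c\<^sup>2)" if y: "y \<in> I" and n: "n > 0" for n y
  proof -
    \<comment> \<open>The derivative of \<open>D n\<close> is oscillating but not small; \<open>R\<close> is of order \<open>1 / n\<close> and integrates it up to
      an error of the same order.\<close>
    define R where "R y = (-1) ^ n * cos (2 * real n * y) / (4 * real n * cos y)" for y :: real
    have dD: "(D n has_field_derivative ((-1) ^ n * sin (2 * real n * z) / (2 * cos z))) (at z within I)"
      if z: "z \<in> I" for z
    proof -
      have "((\<lambda>y. s * cos (m * y) / m) has_field_derivative - (s * sin (m * z))) (at z within I)"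
        if "m \<noteq> 0" for s m :: real
        using that by (auto intro!: derivative_eq_intros)
      then have "(D n has_field_derivative - (\<Sum>k<n. (-1) ^ k * sin (real (2 * k + 1) * z))) (at z within I)"
        unfolding D_def[abs_def] sum_negf[symmetric]
        by (intro DERIV_sum) simp
      moreover have "- (\<Sum>k<n. (-1) ^ k * sin (real (2 * k + 1) * z)) = (-1) ^ n * sin (2 * real n * z) / (2 * cos z)"
        using sum_alternating_sin[of z n] cos_ge[OF z] c0 by (simp add: field_simps)
      ultimately show ?thesis by simp
    qed
    have dR: "(R has_field_derivative
        (- ((-1) ^ n * sin (2 * real n * z) / (2 * cos z)) + (-1) ^ n * cos (2 * real n * z) * sin z / (4 * real n * (cos z)\<^sup>2)))
        (at z within I)" if z: "z \<in> I" for z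
      unfolding R_def[abs_def] using cos_ge[OF z] c0 n
      by (auto intro!: derivative_eq_intros simp: field_simps power2_eq_square)
    have "norm ((D n y + R y) - (D n 0 + R 0)) \<le> 1 / (4 * real n * c\<^sup>2) * norm (y - 0)"
    proof (rule field_differentiable_bound)
      show "convex I" by (simp add: I_def)
      show "y \<in> I" by fact
      show "0 \<in> I" by (simp add: I_def)
      fix z assume z: "z \<in> I"
      show "((\<lambda>y. D n y + R y) has_field_derivative
          ((-1) ^ n * cos (2 * real n * z) * sin z / (4 * real n * (cos z)\<^sup>2))) (at z within I)"
        using DERIV_add[OF dD[OF z] dR[OF z]] by simp
      have "\<bar>cos (2 * real n * z)\<bar> * \<bar>sin z\<bar> \<le> 1 * 1"
        by (intro mult_mono) auto
      then have "norm ((-1) ^ n * cos (2 * real n * z) * sin z / (4 * real n * (cos z)\<^sup>2)) \<le> 1 / (4 * real n * (cos z)\<^sup>2)"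
        by (simp add: abs_mult divide_right_mono)
      also have "\<dots> \<le> 1 / (4 * real n * c\<^sup>2)"
        using n c0 cos_ge[OF z] by (intro divide_left_mono mult_left_mono power_mono mult_pos_pos) auto
      finally show "norm ((-1) ^ n * cos (2 * real n * z) * sin z / (4 * real n * (cos z)\<^sup>2)) \<le> 1 / (4 * real n * c\<^sup>2)" .
    qed
    \<comment> \<open>Here |y| <= |x| < pi/2 < 2. With the two bounds on \<open>R\<close> to come,
      the errors add up to (2 + 1 + 1) / (4 n c^2).\<close>
    also have "\<dots> \<le> 1 / (4 * real n * c\<^sup>2) * 2"
      using y x pi_less_4 by (intro mult_left_mono) (auto simp: I_def)
    finally have 1: "\<bar>(D n y + R y) - (D n 0 + R 0)\<bar> \<le> 2 / (4 * real n * c\<^sup>2)" by simp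
    have R_bound: "\<bar>R z\<bar> \<le> 1 / (4 * real n * c\<^sup>2)" if z: "z \<in> I" for z
    proof -
      have "\<bar>R z\<bar> \<le> 1 / (4 * real n * cos z)"
        using cos_ge[OF z] c0 n by (simp add: R_def abs_mult divide_right_mono)
      also have "\<dots> \<le> 1 / (4 * real n * c\<^sup>2)"
        using n c0 cos_ge[OF z] order.trans[OF cc cos_ge[OF z]] by (intro divide_left_mono mult_left_mono mult_pos_pos) (auto simp: power2_eq_square)
      finally show ?thesis .
    qed
    have "0 \<in> I" by (simp add: I_def)
    note R0 = R_bound[OF this]
    have triangle: "\<bar>a - b\<bar> \<le> p + q + q"
      if "\<bar>(a + u) - (b + w)\<bar> \<le> p" "\<bar>u\<bar> \<le> q" "\<bar>w\<bar> \<le> q" for a b u w p q :: real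
      using that by linarith
    from triangle[OF 1 R_bound[OF y] R0]
    show ?thesis by (simp add: field_simps)
  qed
  have S_bound: "\<bar>S n x - D n 0 * x\<bar> \<le> \<bar>x\<bar> / c\<^sup>2 * (1 / real n)" if n: "n > 0" for n
  proof -
    have "norm ((S n x - D n 0 * x) - (S n 0 - D n 0 * 0)) \<le> 1 / (real n * c\<^sup>2) * norm (x - 0)"
    proof (rule field_differentiable_bound)
      show "convex I" "x \<in> I" "0 \<in> I" by (auto simp: I_def)
      fix z assume z: "z \<in> I"
      show "((\<lambda>y. S n y - D n 0 * y) has_field_derivative (D n z - D n 0)) (at z within I)"
        by (auto intro!: derivative_eq_intros dS)
      show "norm (D n z - D n 0) \<le> 1 / (real n * c\<^sup>2)"
        using D_bound[OF z n] by simp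
    qed
    then show ?thesis by (simp add: S_def mult.commute)
  qed
  have "(\<lambda>n. \<Sum>k<n. (-1) ^ k * (1 / real (k * 2 + 1))) \<longlonglongrightarrow> pi / 4"
    unfolding pi_series using summable_sums[OF summable_arctan_series[of 1]] by (simp add: sums_def)
  then have "(\<lambda>n. D n 0) \<longlonglongrightarrow> pi / 4"
    by (simp add: D_def mult.commute)
  then have lim: "(\<lambda>n. D n 0 * x) \<longlonglongrightarrow> pi / 4 * x"
    by (intro tendsto_intros)
  have "(\<lambda>n. S n x - D n 0 * x) \<longlonglongrightarrow> 0"
  proof (rule Lim_null_comparison)
    show "\<forall>\<^sub>F n in sequentially. norm (S n x - D n 0 * x) \<le> \<bar>x\<bar> / c\<^sup>2 * (1 / real n)"
      using eventually_gt_at_top[of 0] by eventually_elim (use S_bound in auto)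
    show "(\<lambda>n. \<bar>x\<bar> / c\<^sup>2 * (1 / real n)) \<longlonglongrightarrow> 0"
      using tendsto_mult_right_zero lim_1_over_n by blast
  qed
  from tendsto_add[OF this lim] show ?thesis
    by (simp add: S_def)
qed

text \<open>The M-test gives uniform convergence, hence a continuous sum, so the identity passes
  from the open interval to its closure. The endpoints matter: they correspond to the extreme
  frequencies.\<close>

lemma alternating_sin_series:
  fixes x :: real
  assumes x: "\<bar>x\<bar> \<le> pi / 2"
  shows "(\<lambda>k. (-1) ^ k * sin (real (2 * k + 1) * x) / (real (2 * k + 1))\<^sup>2) sums (pi / 4 * x)"
proof -
  define I where "I = {- (pi / 2)..pi / 2}"
  define f where "f k y = (-1) ^ k * sin (real (2 * k + 1) * y) / (real (2 * k + 1))\<^sup>2" for k and y :: real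
  have lim: "uniform_limit I (\<lambda>n y. \<Sum>k<n. f k y) (\<lambda>y. suminf (\<lambda>k. f k y)) sequentially"
  proof (rule Weierstrass_m_test)
    show "norm (f k y) \<le> 1 / (real (2 * k + 1))\<^sup>2" for k y
      by (simp add: f_def abs_mult divide_right_mono)
  qed (rule summable_inverse_odd_squares)
  have "continuous_on I (\<lambda>y. suminf (\<lambda>k. f k y))"
    by (rule uniform_limit_theorem[OF _ lim])
      (auto intro!: always_eventually continuous_intros simp: f_def)
  then have cont: "continuous_on (closure {- (pi / 2)<..<pi / 2}) (\<lambda>y. suminf (\<lambda>k. f k y) - pi / 4 * y)"
    by (auto intro!: continuous_intros simp: I_def)
  have "suminf (\<lambda>k. f k y) - pi / 4 * y = 0" if "y \<in> {- (pi / 2)<..<pi / 2}" for y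
    using alternating_sin_series_interior[of y] that by (auto simp: f_def sums_def[symmetric] sums_iff abs_less_iff)
  with cont have "suminf (\<lambda>k. f k x) - pi / 4 * x = 0"
    by (rule continuous_constant_on_closure) (use x in \<open>auto simp: abs_le_iff\<close>)
  then have "suminf (\<lambda>k. f k x) = pi / 4 * x"
    by (simp only: right_minus_eq)
  moreover have "x \<in> I"
    using x unfolding I_def atLeastAtMost_iff by linarith
  then have "(\<lambda>k. f k x) sums (suminf (\<lambda>k. f k x))"
    using tendsto_uniform_limitI[OF lim] by (simp add: sums_def)
  ultimately have "(\<lambda>k. f k x) sums (pi / 4 * x)"
    by (simp only:)
  then show ?thesis by (simp add: f_def)
qed

section \<open>Replacing an infinite positive combination by a finite one\<close>

text \<open>Restricted to the finite set \<open>X\<close>, the \<open>v k\<close> lie in a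
  finite-dimensional space, so an initial segment spans them all; boundedness of the family keeps
  the coefficients bounded uniformly in \<open>k\<close>. The induction adds one point of
  \<open>X\<close> at a time.\<close>

lemma bounded_finite_generation:
  fixes v :: "nat \<Rightarrow> 'a \<Rightarrow> real"
  assumes "finite X" and bounded: "\<And>k x. x \<in> X \<Longrightarrow> \<bar>v k x\<bar> \<le> B"
  shows "\<exists>K C c. \<forall>k. (\<forall>j. \<bar>c k j\<bar> \<le> C) \<and> (\<forall>x\<in>X. v k x = (\<Sum>j<K. c k j * v j x))"
  using assms
proof (induction X)
  case empty
  show ?case by (rule exI[of _ 0], rule exI[of _ 0], rule exI[of _ "\<lambda>_ _. 0"]) auto
next
  case (insert y X)
  then obtain K0 :: nat and C0 c0 where c0: "\<And>k j. \<bar>c0 k j\<bar> \<le> C0" "\<And>k x. x \<in> X \<Longrightarrow> v k x = (\<Sum>j<K0. c0 k j * v j x)"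
    by (metis insertCI)
  \<comment> \<open>Padding with zeros allows the range of summation to grow beyond
    \<open>K0\<close> without changing the sums.\<close>
  define c where "c k j = (if j < K0 then c0 k j else 0)" for k j
  have C0: "C0 \<ge> 0" using c0(1)[of 0 0] by linarith
  have c_le: "\<bar>c k j\<bar> \<le> C0" for k j using c0(1)[of k j] C0 by (simp add: c_def)
  have c_sum: "(\<Sum>j<K. c k j * v j x) = (\<Sum>j<K0. c0 k j * v j x)" if "K \<ge> K0" for K k x
    by (rule sum.mono_neutral_cong_right) (use that in \<open>auto simp: c_def\<close>)
  define r where "r k = v k y - (\<Sum>j<K0. c k j * v j y)" for k
  have r: "\<bar>r k\<bar> \<le> B + real K0 * (C0 * B)" for k
  proof -
    have "\<bar>\<Sum>j<K0. c k j * v j y\<bar> \<le> (\<Sum>j<K0. C0 * B)"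
      by (rule order.trans[OF sum_abs], rule sum_mono)
        (auto simp: abs_mult intro!: mult_mono c_le insert.prems C0)
    then show ?thesis using insert.prems[of y k] by (simp add: r_def)
  qed
  show ?case
  proof (cases "\<forall>k. r k = 0")
    case True
    have "v k y = (\<Sum>j<K0. c k j * v j y)" for k
      using True[rule_format, of k] unfolding r_def right_minus_eq .
    moreover have "v k x = (\<Sum>j<K0. c k j * v j x)" if "x \<in> X" for k x
      unfolding c_sum[OF order.refl] using that by (rule c0(2))
    ultimately have "\<forall>x\<in>insert y X. v k x = (\<Sum>j<K0. c k j * v j x)" for k
      by blast
    with c_le show ?thesis by blast
  next
    case False
    then obtain m where m: "r m \<noteq> 0" by blast
    \<comment> \<open>The generators must form an initial segment containing both the old ones and
      \<open>v m\<close>, and \<open>m\<close> may lie on either side of \<open>K0\<close>.\<close>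
    define K where "K = max K0 (Suc m)"
    \<comment> \<open>Once \<open>X\<close> is served, the remaining error \<open>r k\<close> at \<open>y\<close> is cancelled by a multiple of the defect of \<open>v m\<close>,
      which vanishes on \<open>X\<close> but not at \<open>y\<close>.\<close>
    define d where "d k j = c k j + r k / r m * ((if j = m then 1 else 0) - c m j)" for k j
    define C where "C = C0 + (B + real K0 * (C0 * B)) / \<bar>r m\<bar> * (1 + C0)"
    have K: "K \<ge> K0" "m < K" by (auto simp: K_def)
    have "\<bar>d k j\<bar> \<le> C" for k j
    proof -
      have "\<bar>r k / r m * ((if j = m then 1 else 0) - c m j)\<bar> \<le> (B + real K0 * (C0 * B)) / \<bar>r m\<bar> * (1 + C0)"
        unfolding abs_mult abs_divide
        using r[of k] c_le[of m j] C0 by (intro mult_mono divide_right_mono) (auto intro: order.trans[OF abs_ge_zero])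
      then show ?thesis using c_le[of k j] unfolding d_def C_def by linarith
    qed
    moreover have "v k x = (\<Sum>j<K. d k j * v j x)" if x: "x \<in> insert y X" for k x
    proof -
      have "(\<Sum>j<K. d k j * v j x) = (\<Sum>j<K. c k j * v j x)
          + r k / r m * ((\<Sum>j<K. (if j = m then 1 else 0) * v j x) - (\<Sum>j<K. c m j * v j x))"
        unfolding d_def distrib_right left_diff_distrib mult.assoc right_diff_distrib
        by (simp only: sum.distrib sum_subtractf sum_distrib_left)
      also have "(\<Sum>j<K. (if j = m then 1 else 0) * v j x) = v m x"
        by (subst sum.remove[of _ m]) (use K in auto)
      also have "(\<Sum>j<K. c k j * v j x) + r k / r m * (v m x - (\<Sum>j<K. c m j * v j x)) = v k x"
      proof (cases "x \<in> X")
        case True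
        then have "(\<Sum>j<K. c k j * v j x) = v k x" for k
          unfolding c_sum[OF K(1)] by (rule c0(2)[symmetric])
        then show ?thesis by simp
      next
        case False
        then have "v m x - (\<Sum>j<K. c m j * v j x) = r m" "(\<Sum>j<K. c k j * v j x) = v k x - r k"
          using x unfolding r_def c_sum[OF K(1)] c_sum[OF order.refl] by auto
        then show ?thesis using m by simp
      qed
      finally show ?thesis by simp
    qed
    ultimately show ?thesis by blast
  qed
qed

text \<open>The tail of the series from \<open>N\<close> on is a combination of the first
  \<open>K\<close> vectors with coefficients tending to 0 as \<open>N\<close> grows. Since the
  weights \<open>w j\<close> are strictly positive, they eventually absorb these coefficients and
  stay nonnegative.\<close>

lemma finite_positive_combination:
  fixes v :: "nat \<Rightarrow> 'a \<Rightarrow> real" and w :: "nat \<Rightarrow> real"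
  assumes "finite X" and bounded: "\<And>k x. x \<in> X \<Longrightarrow> \<bar>v k x\<bar> \<le> B"
    and w: "\<And>k. w k > 0" "summable w"
  obtains N \<mu> where "\<And>k. \<mu> k \<ge> 0" "\<And>x. x \<in> X \<Longrightarrow> (\<Sum>k<N::nat. \<mu> k * v k x) = suminf (\<lambda>k. w k * v k x)"
proof -
  obtain K C c where "\<forall>k. (\<forall>j. \<bar>c k j\<bar> \<le> C) \<and> (\<forall>x\<in>X. v k x = (\<Sum>j<K::nat. c k j * v j x))"
    using bounded_finite_generation[of X v B, OF assms(1) bounded] by blast
  then have c: "\<And>k j. \<bar>c k j\<bar> \<le> C" "\<And>k x. x \<in> X \<Longrightarrow> v k x = (\<Sum>j<K. c k j * v j x)"
    by blast+
  have sc: "summable (\<lambda>k. w k * c k j)" for j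
  proof (rule summable_comparison_test')
    show "summable (\<lambda>k. w k * C)" using w(2) by (rule summable_mult2)
    show "norm (w k * c k j) \<le> w k * C" if "k \<ge> 0" for k
      using w(1)[of k] c(1)[of k j] by (simp add: abs_mult)
  qed
  \<comment> \<open>The total coefficient that the tail from \<open>N\<close> on contributes to
    \<open>v j\<close>.\<close>
  define t where "t N j = suminf (\<lambda>k. w (k + N) * c (k + N) j)" for N j
  have t0: "(\<lambda>N. t N j) \<longlonglongrightarrow> 0" for j
    unfolding t_def using suminf_exist_split2[OF sc] by simp
  \<comment> \<open>Only finitely many \<open>j\<close> receive a correction, so one
    \<open>N\<close> serves them all; \<open>N \<ge> K\<close> then keeps these \<open>j\<close>
    among the retained terms.\<close>
  have "\<forall>\<^sub>F N in sequentially. \<forall>j\<in>{..<K}. \<bar>t N j\<bar> < w j"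
  proof (rule eventually_ball_finite)
    show "\<forall>j\<in>{..<K}. \<forall>\<^sub>F N in sequentially. \<bar>t N j\<bar> < w j"
      using t0 w(1) by (auto simp: tendsto_iff dist_real_def)
  qed simp
  with eventually_ge_at_top[of K] have "\<forall>\<^sub>F N in sequentially. N \<ge> K \<and> (\<forall>j\<in>{..<K}. \<bar>t N j\<bar> < w j)"
    by (rule eventually_conj)
  then obtain N where N: "N \<ge> K" "\<And>j. j < K \<Longrightarrow> \<bar>t N j\<bar> < w j"
    by (auto simp: eventually_sequentially)
  define \<mu> where "\<mu> k = w k + (if k < K then t N k else 0)" for k
  show thesis
  proof
    show "\<mu> k \<ge> 0" for k
      using N(2)[of k] w(1)[of k] by (auto simp: \<mu>_def)
    fix x assume x: "x \<in> X"
    have eq: "w k * v k x = (\<Sum>j<K. w k * c k j * v j x)" for k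
      by (subst c(2)[OF x]) (simp add: sum_distrib_left mult.assoc)
    have summ: "summable (\<lambda>k. w k * v k x)"
      unfolding eq by (intro summable_sum summable_mult2 sc)
    have "suminf (\<lambda>k. w k * v k x) = suminf (\<lambda>k. w (k + N) * v (k + N) x) + (\<Sum>k<N. w k * v k x)"
      by (rule suminf_split_initial_segment[OF summ])
    also have "suminf (\<lambda>k. w (k + N) * v (k + N) x) = (\<Sum>j<K. t N j * v j x)"
    proof -
      have s: "summable (\<lambda>k. w (k + N) * c (k + N) j)" for j
        using summable_ignore_initial_segment[OF sc] .
      show ?thesis
        unfolding eq t_def by (intro sums_unique[symmetric] sums_sum sums_mult2 summable_sums s)
    qed
    also have "(\<Sum>j<K. t N j * v j x) = (\<Sum>j<N. (if j < K then t N j else 0) * v j x)"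
      by (rule sum.mono_neutral_cong_left) (use N in auto)
    finally show "(\<Sum>k<N. \<mu> k * v k x) = suminf (\<lambda>k. w k * v k x)"
      by (simp add: \<mu>_def distrib_right sum.distrib add.commute)
  qed
qed

section \<open>Symbol and cost of rules under convolution\<close>

abbreviation wave :: "real \<Rightarrow> real \<Rightarrow> complex" where
  "wave \<xi> x \<equiv> exp (2 * complex_of_real pi * \<i> * complex_of_real \<xi> * complex_of_real x)"

text \<open>The Fourier transform of the measure: convolution with \<open>\<phi>\<close> multiplies
  \<open>wave \<xi>\<close> by this number.\<close>

definition rule_symbol :: "shift_rule \<Rightarrow> real \<Rightarrow> complex" where
  "rule_symbol \<phi> \<xi> = (\<Sum>a\<in>Poly_Mapping.keys \<phi>. complex_of_real (Poly_Mapping.lookup \<phi> a) * wave \<xi> (- a))"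

lemma wave_add: "wave \<xi> (x + y) = wave \<xi> x * wave \<xi> y"
  by (simp add: algebra_simps flip: exp_add)

lemma norm_wave [simp]: "norm (wave \<xi> x) = 1"
  by (simp add: norm_exp_eq_Re)

lemma poly_mapping_sum_singles:
  fixes \<phi> :: "'a \<Rightarrow>\<^sub>0 'b :: comm_monoid_add"
  shows "\<phi> = (\<Sum>a\<in>Poly_Mapping.keys \<phi>. Poly_Mapping.single a (Poly_Mapping.lookup \<phi> a))"
proof (rule poly_mapping_eqI)
  fix k
  have "(\<Sum>a\<in>Poly_Mapping.keys \<phi>. Poly_Mapping.lookup (Poly_Mapping.single a (Poly_Mapping.lookup \<phi> a)) k)
      = (\<Sum>a\<in>Poly_Mapping.keys \<phi>. if a = k then Poly_Mapping.lookup \<phi> k else 0)"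
    by (rule sum.cong) (auto simp: lookup_single)
  then show "Poly_Mapping.lookup \<phi> k =
      Poly_Mapping.lookup (\<Sum>a\<in>Poly_Mapping.keys \<phi>. Poly_Mapping.single a (Poly_Mapping.lookup \<phi> a)) k"
    by (simp add: lookup_sum sum.delta in_keys_iff)
qed

text \<open>The product of \<open>poly_mapping\<close> is convolution over the additive group of
  shifts. This form reduces symbol and cost of a product to point masses.\<close>

lemma times_poly_mapping_sum_singles:
  fixes \<phi> \<psi> :: "'a :: monoid_add \<Rightarrow>\<^sub>0 'b :: semiring_0"
  shows "\<phi> * \<psi> = (\<Sum>a\<in>Poly_Mapping.keys \<phi>. \<Sum>b\<in>Poly_Mapping.keys \<psi>.
    Poly_Mapping.single (a + b) (Poly_Mapping.lookup \<phi> a * Poly_Mapping.lookup \<psi> b))"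
  by (subst poly_mapping_sum_singles[of \<phi>], subst poly_mapping_sum_singles[of \<psi>])
    (simp add: sum_product mult_single)

text \<open>Masses may cancel in a sum of rules and shrink its support; a common finite superset
  allows termwise comparison.\<close>

lemma rule_symbol_superset:
  assumes "finite A" "Poly_Mapping.keys \<phi> \<subseteq> A"
  shows "rule_symbol \<phi> \<xi> = (\<Sum>a\<in>A. complex_of_real (Poly_Mapping.lookup \<phi> a) * wave \<xi> (- a))"
  unfolding rule_symbol_def
  by (rule sum.mono_neutral_left) (use assms in \<open>auto simp: in_keys_iff\<close>)

lemma rule_cost_superset:
  assumes "finite A" "Poly_Mapping.keys \<phi> \<subseteq> A"
  shows "rule_cost \<phi> = (\<Sum>a\<in>A. \<bar>Poly_Mapping.lookup \<phi> a\<bar>)"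
  unfolding rule_cost_def
  by (rule sum.mono_neutral_left) (use assms in \<open>auto simp: in_keys_iff\<close>)

lemma rule_symbol_single: "rule_symbol (Poly_Mapping.single a u) \<xi> = complex_of_real u * wave \<xi> (- a)"
  by (subst rule_symbol_superset[of "{a}"]) auto

lemma rule_cost_single: "rule_cost (Poly_Mapping.single a u) = \<bar>u\<bar>"
  by (subst rule_cost_superset[of "{a}"]) auto

lemma rule_symbol_add: "rule_symbol (\<phi> + \<psi>) \<xi> = rule_symbol \<phi> \<xi> + rule_symbol \<psi> \<xi>"
proof -
  define A where "A = Poly_Mapping.keys \<phi> \<union> Poly_Mapping.keys \<psi>"
  have A: "finite A" "Poly_Mapping.keys \<phi> \<subseteq> A" "Poly_Mapping.keys \<psi> \<subseteq> A" "Poly_Mapping.keys (\<phi> + \<psi>) \<subseteq> A"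
    using Poly_Mapping.keys_add[of \<phi> \<psi>] by (auto simp: A_def)
  show ?thesis
    by (simp add: A(2-) rule_symbol_superset[OF A(1)] lookup_add distrib_right sum.distrib)
qed

lemma rule_cost_add: "rule_cost (\<phi> + \<psi>) \<le> rule_cost \<phi> + rule_cost \<psi>"
proof -
  define A where "A = Poly_Mapping.keys \<phi> \<union> Poly_Mapping.keys \<psi>"
  have A: "finite A" "Poly_Mapping.keys \<phi> \<subseteq> A" "Poly_Mapping.keys \<psi> \<subseteq> A" "Poly_Mapping.keys (\<phi> + \<psi>) \<subseteq> A"
    using Poly_Mapping.keys_add[of \<phi> \<psi>] by (auto simp: A_def)
  show ?thesis
    by (auto simp add: A(2-) rule_cost_superset[OF A(1)] lookup_add sum.distrib[symmetric] intro!: sum_mono)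
qed

lemma rule_symbol_zero [simp]: "rule_symbol 0 \<xi> = 0"
  by (simp add: rule_symbol_def)

lemma rule_cost_zero [simp]: "rule_cost 0 = 0"
  by (simp add: rule_cost_def)

lemma rule_symbol_sum: "rule_symbol (sum \<phi> I) \<xi> = (\<Sum>i\<in>I. rule_symbol (\<phi> i) \<xi>)"
  by (induction I rule: infinite_finite_induct) (simp_all add: rule_symbol_add)

lemma rule_cost_sum: "rule_cost (sum \<phi> I) \<le> (\<Sum>i\<in>I. rule_cost (\<phi> i))"
  by (induction I rule: infinite_finite_induct) (auto intro: order.trans[OF rule_cost_add])

lemma rule_symbol_mult: "rule_symbol (\<phi> * \<psi>) \<xi> = rule_symbol \<phi> \<xi> * rule_symbol \<psi> \<xi>"
proof -
  have "wave \<xi> (- (a + b)) = wave \<xi> (- a) * wave \<xi> (- b)" for a b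
    using wave_add[of \<xi> "- a" "- b"] by simp
  then show ?thesis
    unfolding times_poly_mapping_sum_singles[of \<phi> \<psi>] rule_symbol_sum rule_symbol_single
    by (simp only: rule_symbol_def sum_product of_real_mult mult_ac)
qed

text \<open>Only an inequality, since different pairs may give the same point \<open>a + b\<close>
  and their masses may cancel there.\<close>

lemma rule_cost_mult: "rule_cost (\<phi> * \<psi>) \<le> rule_cost \<phi> * rule_cost \<psi>"
proof -
  have "rule_cost (\<phi> * \<psi>) \<le> (\<Sum>a\<in>Poly_Mapping.keys \<phi>. \<Sum>b\<in>Poly_Mapping.keys \<psi>.
      rule_cost (Poly_Mapping.single (a + b) (Poly_Mapping.lookup \<phi> a * Poly_Mapping.lookup \<psi> b)))"
    unfolding times_poly_mapping_sum_singles[of \<phi> \<psi>]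
    by (rule order.trans[OF rule_cost_sum]) (intro sum_mono rule_cost_sum)
  then show ?thesis
    by (simp only: rule_cost_single) (simp only: rule_cost_def sum_product abs_mult)
qed

lemma rule_cost_nonneg: "0 \<le> rule_cost \<phi>"
  by (simp add: rule_cost_def sum_nonneg)

lemma rule_symbol_power: "rule_symbol (\<phi> ^ n) \<xi> = rule_symbol \<phi> \<xi> ^ n"
  by (induction n) (simp_all add: rule_symbol_mult rule_symbol_single flip: single_one)

lemma rule_cost_power: "rule_cost (\<phi> ^ n) \<le> rule_cost \<phi> ^ n"
proof (induction n)
  case 0
  show ?case by (simp add: rule_cost_single flip: single_one)
next
  case (Suc n)
  then show ?case
    by (auto intro: order.trans[OF rule_cost_mult] mult_left_mono rule_cost_nonneg)
qed

section \<open>Exponential sums under differentiation and shift rules\<close>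

text \<open>Differentiate the complex sum and split it: the real part is the derivative of
  \<open>g\<close>, and the imaginary part is the derivative of the constant 0.\<close>

lemma deriv_exponential_sum:
  assumes g: "\<And>x. complex_of_real (g x) = (\<Sum>\<xi>\<in>\<Xi>. b \<xi> * wave \<xi> x)"
  shows "complex_of_real (deriv g x) = (\<Sum>\<xi>\<in>\<Xi>. 2 * of_real pi * \<i> * of_real \<xi> * b \<xi> * wave \<xi> x)"
    (is "_ = ?D")
proof -
  have d: "((\<lambda>x. \<Sum>\<xi>\<in>\<Xi>. b \<xi> * wave \<xi> x) has_vector_derivative ?D) (at x)"
    by (auto intro!: derivative_eq_intros sum.cong has_vector_derivative_real_field simp: mult_ac)
  have "((\<lambda>x. complex_of_real (g x)) has_vector_derivative ?D) (at x)"
    using d by (simp only: g)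
  note D = bounded_linear.has_vector_derivative[OF bounded_linear_Re this] bounded_linear.has_vector_derivative[OF bounded_linear_Im this]
  then have "(g has_vector_derivative Re ?D) (at x)" "((\<lambda>_. 0) has_vector_derivative Im ?D) (at x)"
    by simp_all
  then have "deriv g x = Re ?D" "Im ?D = 0"
    by (auto simp: has_real_derivative_iff_has_vector_derivative[symmetric] intro: DERIV_imp_deriv DERIV_unique[OF _ DERIV_const])
  then show ?thesis by (simp add: complex_eq_iff)
qed

lemma higher_deriv_exponential_sum:
  assumes g: "\<And>x. complex_of_real (g x) = (\<Sum>\<xi>\<in>\<Xi>. b \<xi> * wave \<xi> x)"
  shows "complex_of_real ((deriv ^^ n) g x) = (\<Sum>\<xi>\<in>\<Xi>. (2 * of_real pi * \<i> * of_real \<xi>) ^ n * b \<xi> * wave \<xi> x)"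
proof (induction n arbitrary: x)
  case (Suc n)
  show ?case
    using deriv_exponential_sum[OF Suc, of x] by (simp add: mult.assoc)
qed (simp add: g)

lemma apply_rule_exponential_sum:
  assumes g: "\<And>x. complex_of_real (g x) = (\<Sum>\<xi>\<in>\<Xi>. b \<xi> * wave \<xi> x)"
  shows "complex_of_real (apply_rule \<phi> g x) = (\<Sum>\<xi>\<in>\<Xi>. rule_symbol \<phi> \<xi> * b \<xi> * wave \<xi> x)"
proof -
  have "complex_of_real (apply_rule \<phi> g x) = (\<Sum>a\<in>Poly_Mapping.keys \<phi>. \<Sum>\<xi>\<in>\<Xi>.
      of_real (Poly_Mapping.lookup \<phi> a) * wave \<xi> (- a) * b \<xi> * wave \<xi> x)"
    unfolding apply_rule_def of_real_sum of_real_mult g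
  proof (rule sum.cong[OF refl])
    fix a
    have "wave \<xi> (x - a) = wave \<xi> (- a) * wave \<xi> x" for \<xi>
      using wave_add[of \<xi> "- a" x] by simp
    then show "of_real (Poly_Mapping.lookup \<phi> a) * (\<Sum>\<xi>\<in>\<Xi>. b \<xi> * wave \<xi> (x - a)) =
        (\<Sum>\<xi>\<in>\<Xi>. of_real (Poly_Mapping.lookup \<phi> a) * wave \<xi> (- a) * b \<xi> * wave \<xi> x)"
      by (simp only: sum_distrib_left mult_ac)
  qed
  also have "\<dots> = (\<Sum>\<xi>\<in>\<Xi>. rule_symbol \<phi> \<xi> * b \<xi> * wave \<xi> x)"
    unfolding rule_symbol_def sum_distrib_right by (rule sum.swap)
  finally show ?thesis .
qed

text \<open>Rules and derivatives both act diagonally on the exponentials, so it is enough to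
  compare eigenvalues at the frequencies in \<open>\<Xi>\<close>.\<close>

lemma feasible_rule_if_symbol:
  assumes "\<And>\<xi>. \<xi> \<in> \<Xi> \<Longrightarrow> rule_symbol \<phi> \<xi> = (2 * of_real pi * \<i> * of_real \<xi>) ^ n"
  shows "feasible_rule \<Xi> n \<phi>"
  unfolding feasible_rule_def
proof (intro ballI ext)
  fix g x
  assume "g \<in> fun_space \<Xi>"
  then obtain b where g: "\<And>x. complex_of_real (g x) = (\<Sum>\<xi>\<in>\<Xi>. b \<xi> * wave \<xi> x)"
    by (auto simp: fun_space_def)
  have "complex_of_real (apply_rule \<phi> g x) = complex_of_real ((deriv ^^ n) g x)"
    unfolding apply_rule_exponential_sum[OF g] higher_deriv_exponential_sum[OF g]
    by (rule sum.cong) (simp_all add: assms)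
  then show "apply_rule \<phi> g x = (deriv ^^ n) g x"
    by (simp only: of_real_eq_iff)
qed

section \<open>Weak duality\<close>

text \<open>The supremum is taken in the reals, so an upper bound must be supplied: the sum of the
  norms of the coefficients.\<close>

lemma abs_le_sup_norm:
  assumes "g \<in> fun_space \<Xi>"
  shows "\<bar>g x\<bar> \<le> sup_norm g"
proof -
  obtain b where g: "\<And>x. complex_of_real (g x) = (\<Sum>\<xi>\<in>\<Xi>. b \<xi> * wave \<xi> x)"
    using assms by (auto simp: fun_space_def)
  have "\<bar>g x\<bar> \<le> (\<Sum>\<xi>\<in>\<Xi>. norm (b \<xi>))" for x
  proof -
    have "\<bar>g x\<bar> = norm (\<Sum>\<xi>\<in>\<Xi>. b \<xi> * wave \<xi> x)"
      by (metis g norm_of_real)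
    also have "\<dots> \<le> (\<Sum>\<xi>\<in>\<Xi>. norm (b \<xi> * wave \<xi> x))" by (rule norm_sum)
    finally show ?thesis by (simp only: norm_mult norm_wave mult_1_right)
  qed
  then show ?thesis
    unfolding sup_norm_def by (intro cSUP_upper bdd_aboveI2) auto
qed

text \<open>A feasible rule writes the derivative at 0 as a weighted sum of values of
  \<open>g\<close>, each of absolute value at most 1.\<close>

lemma weak_duality:
  assumes "feasible_rule \<Xi> n \<phi>" "g \<in> dual_feasible \<Xi>"
  shows "dual_objective n g \<le> rule_cost \<phi>"
proof -
  have g: "g \<in> fun_space \<Xi>" "sup_norm g \<le> 1"
    using assms(2) by (auto simp: dual_feasible_def)
  have "dual_objective n g \<le> \<bar>(deriv ^^ n) g 0\<bar>"
    unfolding dual_objective_def using abs_ge_self[of "(- 1) ^ n * (deriv ^^ n) g 0"] by (simp add: abs_mult)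
  also have "(deriv ^^ n) g 0 = apply_rule \<phi> g 0"
    using assms(1) g(1) by (simp add: feasible_rule_def)
  also have "\<bar>apply_rule \<phi> g 0\<bar> \<le> (\<Sum>a\<in>Poly_Mapping.keys \<phi>. \<bar>Poly_Mapping.lookup \<phi> a\<bar> * \<bar>g (0 - a)\<bar>)"
    unfolding apply_rule_def abs_mult[symmetric] by (rule sum_abs)
  also have "\<dots> \<le> (\<Sum>a\<in>Poly_Mapping.keys \<phi>. \<bar>Poly_Mapping.lookup \<phi> a\<bar> * 1)"
    using abs_le_sup_norm[OF g(1)] g(2) by (intro sum_mono mult_left_mono) (auto intro: order.trans)
  finally show ?thesis by (simp add: rule_cost_def)
qed

section \<open>Trigonometric preliminaries\<close>

text \<open>Treating each derivative as a phase advance of pi/2 avoids a case distinction modulo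
  4.\<close>

lemma higher_deriv_cos:
  fixes c d :: real
  shows "(deriv ^^ n) (\<lambda>x. cos (c * x + d)) = (\<lambda>x. c ^ n * cos (c * x + d + real n * (pi / 2)))"
proof (induction n)
  case (Suc n)
  have "deriv (\<lambda>x. c ^ n * cos (c * x + d + real n * (pi / 2))) x
      = c ^ Suc n * cos (c * x + d + real (Suc n) * (pi / 2))" for x
  proof -
    have "cos (c * x + d + real (Suc n) * (pi / 2)) = cos ((c * x + d + real n * (pi / 2)) + pi / 2)"
      by (simp add: algebra_simps add_divide_distrib)
    then have "cos (c * x + d + real (Suc n) * (pi / 2)) = - sin (c * x + d + real n * (pi / 2))"
      by (simp only: cos_add) simp
    then show ?thesis
      by (intro DERIV_imp_deriv) (auto intro!: derivative_eq_intros)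
  qed
  then show ?case by (simp add: Suc)
qed simp

lemma wave_diff_sin: "wave \<xi> x - wave \<xi> (- x) = 2 * \<i> * complex_of_real (sin (2 * pi * \<xi> * x))"
proof -
  have "2 * complex_of_real pi * \<i> * complex_of_real \<xi> * complex_of_real x = \<i> * complex_of_real (2 * pi * \<xi> * x)"
    "2 * complex_of_real pi * \<i> * complex_of_real \<xi> * complex_of_real (- x) = - (\<i> * complex_of_real (2 * pi * \<xi> * x))"
    by simp_all
  then show ?thesis
    by (simp only: sin_exp_eq flip: sin_of_real) simp
qed

lemma sin_odd_multiple_half_pi: "sin (real (2 * k + 1) * (pi / 2)) = (-1) ^ k"
proof -
  have "sin (real (2 * k + 1) * (pi / 2)) = sin (real k * pi + pi / 2)"
    by (simp add: algebra_simps add_divide_distrib)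
  then show ?thesis by (simp add: sin_add)
qed

section \<open>A finite optimal rule for the first derivative\<close>

lemma first_derivative_rule:
  assumes "finite \<Xi>" "M \<in> \<Xi>" "M \<ge> 0" and bound: "\<And>\<xi>. \<xi> \<in> \<Xi> \<Longrightarrow> \<bar>\<xi>\<bar> \<le> M"
  obtains \<phi> where "\<And>\<xi>. \<xi> \<in> \<Xi> \<Longrightarrow> rule_symbol \<phi> \<xi> = 2 * of_real pi * \<i> * of_real \<xi>" "rule_cost \<phi> \<le> 2 * pi * M"
proof (cases "M = 0")
  case True
  \<comment> \<open>Here 0 is the only frequency, and the zero rule differentiates
    constants.\<close>
  then show thesis using bound by (intro that[of 0]) auto
next
  case False
  with assms have M: "M > 0" by simp
  \<comment> \<open>The scaling maps [-M, M] onto [-pi/2, pi/2], where the series represents a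
    linear function.\<close>
  define x where "x \<xi> = pi * \<xi> / (2 * M)" for \<xi>
  \<comment> \<open>The sign belongs to the vector, so that the weights \<open>w\<close> and
    \<open>\<mu>\<close> are nonnegative; it returns in \<open>u\<close>.\<close>
  define v where "v k \<xi> = (-1) ^ k * sin (real (2 * k + 1) * x \<xi>)" for k \<xi>
  define w where "w k = 1 / (real (2 * k + 1))\<^sup>2" for k
  have "\<bar>v k \<xi>\<bar> \<le> 1" for k \<xi> by (simp add: v_def abs_mult)
  moreover have "w k > 0" for k by (simp add: w_def)
  moreover have "summable w"
    unfolding w_def[abs_def] by (rule summable_inverse_odd_squares)
  ultimately obtain N \<mu> where \<mu>: "\<And>k. \<mu> k \<ge> 0"
    "\<And>\<xi>. \<xi> \<in> \<Xi> \<Longrightarrow> (\<Sum>k<N::nat. \<mu> k * v k \<xi>) = suminf (\<lambda>k. w k * v k \<xi>)"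
    using finite_positive_combination[of \<Xi> v 1 w] \<open>finite \<Xi>\<close> by blast
  have sum_v: "(\<Sum>k<N. \<mu> k * v k \<xi>) = pi / 4 * x \<xi>" if "\<xi> \<in> \<Xi>" for \<xi>
  proof -
    have "\<bar>x \<xi>\<bar> \<le> pi / 2"
      using bound[OF that] M by (simp add: x_def abs_mult field_simps)
    from alternating_sin_series[OF this] have "(\<lambda>k. w k * v k \<xi>) sums (pi / 4 * x \<xi>)"
      by (simp add: w_def v_def)
    then show ?thesis using \<mu>(2)[OF that] by (simp add: sums_iff)
  qed
  \<comment> \<open>The nodes are the positive points where \<open>sin (2 * pi * M * a)\<close> is 1
    or -1. The factor \<open>8 * M / pi\<close> in \<open>u\<close> turns the value
    \<open>pi / 4 * x \<xi>\<close> of the series into \<open>pi * \<xi>\<close>.\<close>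
  define a where "a k = real (2 * k + 1) / (4 * M)" for k
  define u where "u k = 8 * M / pi * (\<mu> k * (-1) ^ k)" for k
  \<comment> \<open>A mass at \<open>a\<close> contributes \<open>wave \<xi> (- a)\<close> to the
    symbol, so the positive sign goes to \<open>- a k\<close>.\<close>
  define \<phi> where "\<phi> = (\<Sum>k<N. Poly_Mapping.single (- a k) (u k) + Poly_Mapping.single (a k) (- u k))"
  show thesis
  proof (rule that)
    fix \<xi> assume \<xi>: "\<xi> \<in> \<Xi>"
    have arg: "2 * pi * \<xi> * a k = real (2 * k + 1) * x \<xi>" for k
      using M by (simp add: a_def x_def field_simps)
    have "rule_symbol \<phi> \<xi> = (\<Sum>k<N. complex_of_real (u k) * (wave \<xi> (a k) - wave \<xi> (- a k)))"
      by (simp add: \<phi>_def rule_symbol_sum rule_symbol_add rule_symbol_single right_diff_distrib)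
    also have "\<dots> = (\<Sum>k<N. 2 * \<i> * complex_of_real (8 * M / pi * (\<mu> k * v k \<xi>)))"
      unfolding wave_diff_sin arg by (intro sum.cong) (simp_all add: u_def v_def)
    also have "\<dots> = 2 * \<i> * complex_of_real (8 * M / pi * (\<Sum>k<N. \<mu> k * v k \<xi>))"
      by (simp only: sum_distrib_left of_real_sum)
    also have "8 * M / pi * (\<Sum>k<N. \<mu> k * v k \<xi>) = pi * \<xi>"
      unfolding sum_v[OF \<xi>] using M by (simp add: x_def)
    finally show "rule_symbol \<phi> \<xi> = 2 * of_real pi * \<i> * of_real \<xi>"
      by simp
  next
    \<comment> \<open>At the top frequency all terms have the same sign, so the symbol there
      determines the sum of the \<open>\<mu> k\<close>, and with it the bound on the cost.\<close>
    have "v k M = 1" for k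
      using M sin_odd_multiple_half_pi[of k] unfolding v_def x_def by (simp flip: power_add)
    with sum_v[OF \<open>M \<in> \<Xi>\<close>] have sum_\<mu>: "(\<Sum>k<N. \<mu> k) = pi / 4 * (pi / 2)"
      using M by (simp add: x_def)
    have "rule_cost \<phi> \<le> (\<Sum>k<N. rule_cost (Poly_Mapping.single (- a k) (u k)) + rule_cost (Poly_Mapping.single (a k) (- u k)))"
      unfolding \<phi>_def by (rule order.trans[OF rule_cost_sum]) (intro sum_mono rule_cost_add)
    also have "\<dots> = (\<Sum>k<N. 16 * M / pi * \<mu> k)"
      using M \<mu>(1) by (simp add: rule_cost_single u_def abs_mult mult.assoc)
    also have "\<dots> = 2 * pi * M"
      unfolding sum_distrib_left[symmetric] sum_\<mu> by simp
    finally show "rule_cost \<phi> \<le> 2 * pi * M" .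
  qed
qed

section \<open>The extremal function and optimality\<close>

lemma extremal_function:
  fixes \<Xi> :: "real set" and M :: real and n :: nat
  assumes "finite \<Xi>" "M \<in> \<Xi>" "- M \<in> \<Xi>"
  defines "f \<equiv> \<lambda>a. (deriv ^^ n) cos (2 * pi * M * a)"
  shows "f \<in> dual_feasible \<Xi>" "dual_objective n f = (2 * pi * M) ^ n"
proof -
  define d where "d = real n * (pi / 2)"
  have f: "f = (\<lambda>x. cos (2 * pi * M * x + d))"
    unfolding f_def d_def using higher_deriv_cos[of n 1 0] by simp
  define c where "c = exp (\<i> * of_real d) / 2"
  \<comment> \<open>The Euler coefficients of the cosine. Adding two conditionals instead of nesting
    them also covers \<open>M = 0\<close>, where both contribute at the same frequency.\<close>
  define b where "b \<xi> = (if \<xi> = M then c else 0) + (if \<xi> = - M then cnj c else 0)" for \<xi>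
  have "b (- \<xi>) = cnj (b \<xi>)" for \<xi>
    by (auto simp: b_def)
  moreover have "complex_of_real (f x) = (\<Sum>\<xi>\<in>\<Xi>. b \<xi> * wave \<xi> x)" for x
  proof -
    have "(\<Sum>\<xi>\<in>\<Xi>. b \<xi> * wave \<xi> x)
        = (\<Sum>\<xi>\<in>\<Xi>. (if \<xi> = M then c * wave M x else 0) + (if \<xi> = - M then cnj c * wave (- M) x else 0))"
      by (rule sum.cong) (auto simp: b_def distrib_right)
    also have "\<dots> = c * wave M x + cnj c * wave (- M) x"
      using assms(1-3) by (simp add: sum.distrib sum.delta)
    also have "\<dots> = (exp (\<i> * of_real (2 * pi * M * x + d)) + exp (- (\<i> * of_real (2 * pi * M * x + d)))) / 2"
      by (simp add: c_def exp_cnj add_divide_distrib algebra_simps flip: exp_add)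
    also have "\<dots> = complex_of_real (f x)"
      unfolding f cos_of_real[symmetric] cos_exp_eq ..
    finally show ?thesis by simp
  qed
  ultimately have "f \<in> fun_space \<Xi>"
    by (auto simp: fun_space_def)
  moreover have "sup_norm f \<le> 1"
    unfolding sup_norm_def f by (rule cSUP_least) auto
  ultimately show "f \<in> dual_feasible \<Xi>"
    by (simp add: dual_feasible_def)
  \<comment> \<open>The phase \<open>n * pi / 2\<close> of \<open>f\<close> and that of its
    \<open>n\<close>-th derivative add up to \<open>n * pi\<close>, whose cosine cancels the sign in
    the objective.\<close>
  have "(deriv ^^ n) f 0 = (2 * pi * M) ^ n * cos (real n * pi)"
    unfolding f higher_deriv_cos by (simp add: d_def)
  then show "dual_objective n f = (2 * pi * M) ^ n"
    by (simp add: dual_objective_def flip: power_mult_distrib)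
qed

theorem theorem11:
  fixes \<alpha> :: nat and \<Xi> :: "real set"
  assumes "\<alpha> \<ge> 1"
    and "finite \<Xi>" and "\<Xi> \<noteq> {}" and "symmetric_set \<Xi>"
  shows "dual_optimal \<Xi> \<alpha> (\<lambda>a. (deriv ^^ \<alpha>) cos (2 * pi * Max \<Xi> * a))
    \<and> (\<exists>\<phi>. optimal_rule \<Xi> \<alpha> \<phi>)
    \<and> (\<forall>\<phi>. optimal_rule \<Xi> \<alpha> \<phi> \<longrightarrow> rule_cost \<phi> = (2 * pi * Max \<Xi>) ^ \<alpha>)"
proof -
  define M where "M = Max \<Xi>"
  define f where "f = (\<lambda>a. (deriv ^^ \<alpha>) cos (2 * pi * M * a))"
  have neg: "- \<xi> \<in> \<Xi>" if "\<xi> \<in> \<Xi>" for \<xi>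
    using assms(4) that unfolding symmetric_set_def by blast
  have M: "M \<in> \<Xi>" "\<And>\<xi>. \<xi> \<in> \<Xi> \<Longrightarrow> \<xi> \<le> M"
    using assms(2,3) by (simp_all add: M_def)
  \<comment> \<open>By symmetry the maximum of \<open>\<Xi>\<close> is also its largest absolute
    value.\<close>
  have bound: "\<bar>\<xi>\<bar> \<le> M" if "\<xi> \<in> \<Xi>" for \<xi>
    using M(2)[OF that] M(2)[OF neg[OF that]] by linarith
  then have "M \<ge> 0" using M(1) by fastforce
  then obtain \<phi> where \<phi>: "\<And>\<xi>. \<xi> \<in> \<Xi> \<Longrightarrow> rule_symbol \<phi> \<xi> = 2 * of_real pi * \<i> * of_real \<xi>"
    "rule_cost \<phi> \<le> 2 * pi * M"
    using first_derivative_rule[OF assms(2) M(1) _ bound] by blast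
  have feasible: "feasible_rule \<Xi> \<alpha> (\<phi> ^ \<alpha>)"
    by (rule feasible_rule_if_symbol) (simp only: rule_symbol_power \<phi>(1))
  have cost_le: "rule_cost (\<phi> ^ \<alpha>) \<le> (2 * pi * M) ^ \<alpha>"
    using rule_cost_power power_mono[OF \<phi>(2) rule_cost_nonneg] by (rule order.trans)
  note f = extremal_function[OF assms(2) M(1) neg[OF M(1)], of \<alpha>, folded f_def]
  \<comment> \<open>The value of \<open>f\<close> bounds every feasible cost from below, and the
    power of \<open>\<phi>\<close> attains it; each certifies the optimality of the other.\<close>
  have cost_ge: "(2 * pi * M) ^ \<alpha> \<le> rule_cost \<psi>" if "feasible_rule \<Xi> \<alpha> \<psi>" for \<psi>
    using weak_duality[OF that f(1)] f(2) by simp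
  have cost: "rule_cost (\<phi> ^ \<alpha>) = (2 * pi * M) ^ \<alpha>"
    using cost_le cost_ge[OF feasible] by simp
  have inf: "(INF \<psi>\<in>{\<psi>. feasible_rule \<Xi> \<alpha> \<psi>}. rule_cost \<psi>) = (2 * pi * M) ^ \<alpha>"
    by (rule cInf_eq_minimum) (use cost feasible cost_ge in force)+
  have "dual_optimal \<Xi> \<alpha> f"
    using f weak_duality[OF feasible] cost by (simp add: dual_optimal_def)
  moreover have "optimal_rule \<Xi> \<alpha> (\<phi> ^ \<alpha>)"
    by (simp add: optimal_rule_def feasible cost inf)
  ultimately show ?thesis
    unfolding f_def M_def[symmetric] by (auto simp: optimal_rule_def inf)
qed

end
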